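(* For every integer $k\ge 2$, $\eta_k\le\mu_k$, where $$\mu_k=R_k\cdot\min\{\beta(p^\alpha):p^\alpha\,\|\,k\},$$ $$R_k=\prod_{p^\alpha\|k}\frac{(p-1)p^{\alpha-1}}{\big(p^\alpha-p^{\alpha-1}-p^{(\alpha-1)/2}+p^{\alpha-1/2}\big)^2},\qquad \beta(p^\alpha)=\frac{\big(p^\alpha-p^{\alpha-1}-p^{(\alpha-1)/2}+p^{\alpha-1/2}\big)^2}{(p-1)\big(-p^{(\alpha-1)/2}+p^{\alpha-1}+p^{\alpha-1/2}\big)^2}.$$
   Context: $p^\alpha\|k$ means $p$ is a prime dividing $k$ and $\alpha\ge1$ is the exact exponent of $p$ in $k$. For $k\ge 2$, $\eta_k=\min_{\mathcal I}|\mathcal I|/T_{\mathcal I}^2$, the minimum over all nonempty subsets $\mathcal I$ of $\{1\le i\le k:\gcd(i,k)=1,\ \gcd(i-1,k)>1\}$, with $T_{\mathcal I}=\sum_{i\in\mathcal I}\sqrt{\gcd(i-1,k)}$. *)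

theory Defs
  imports Complex_Main "HOL-Computational_Algebra.Primes"
begin

text \<open>The relation \<open>p\<^sup>\<alpha> \<parallel> k\<close>; for \<open>k > 0\<close> it entails \<open>\<alpha> \<ge> 1\<close>.\<close>

definition exact_prime_powers :: "nat \<Rightarrow> (nat \<times> nat) set" where
  "exact_prime_powers k = {(p, \<alpha>). prime p \<and> p dvd k \<and> \<alpha> = multiplicity p k}"

definition base_set :: "nat \<Rightarrow> nat set" where
  "base_set k = {i. 1 \<le> i \<and> i \<le> k \<and> gcd i k = 1 \<and> gcd (i - 1) k > 1}"

definition T_sum :: "nat \<Rightarrow> nat set \<Rightarrow> real" where
  "T_sum k I = (\<Sum>i\<in>I. sqrt (real (gcd (i - 1) k)))"

definition eta :: "nat \<Rightarrow> real" where
  "eta k = Min {real (card I) / (T_sum k I)\<^sup>2 | I. I \<subseteq> base_set k \<and> I \<noteq> {}}"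

definition R_factor :: "nat \<Rightarrow> nat \<Rightarrow> real" where
  "R_factor p \<alpha> =
    (real p - 1) * real p powr (real \<alpha> - 1) /
    (real p powr real \<alpha> - real p powr (real \<alpha> - 1)
      - real p powr ((real \<alpha> - 1) / 2) + real p powr (real \<alpha> - 1 / 2))\<^sup>2"

definition R_prod :: "nat \<Rightarrow> real" where
  "R_prod k = (\<Prod>(p, \<alpha>)\<in>exact_prime_powers k. R_factor p \<alpha>)"

definition beta :: "nat \<Rightarrow> nat \<Rightarrow> real" where
  "beta p \<alpha> =
    (real p powr real \<alpha> - real p powr (real \<alpha> - 1)
      - real p powr ((real \<alpha> - 1) / 2) + real p powr (real \<alpha> - 1 / 2))\<^sup>2 /
    ((real p - 1) *
      (- (real p powr ((real \<alpha> - 1) / 2)) + real p powr (real \<alpha> - 1)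
        + real p powr (real \<alpha> - 1 / 2))\<^sup>2)"

definition mu :: "nat \<Rightarrow> real" where
  "mu k = R_prod k * Min {beta p \<alpha> | p \<alpha>. (p, \<alpha>) \<in> exact_prime_powers k}"

end

theory Submission
  imports Defs "HOL-Number_Theory.Cong"
begin

text \<open>
  For a prime q dividing k let I consist of all units i modulo k with i congruent to 1 modulo q.
  By the Chinese remainder theorem both the size of I and the sum T over I factor over
  the prime powers exactly dividing k. The local factors are computed in closed form, and
  they give exactly \<open>|I| / T\<^sup>2 = R\<^sub>k \<cdot> \<beta>(q\<^sup>\<alpha>)\<close>; now choose q so that \<open>\<beta>\<close> is minimal.
\<close>

text \<open>
  With \<open>x = i - 1\<close> these are the units \<open>i\<close> modulo \<open>m\<close> that are 1 modulo \<open>q\<close>. Writing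
  \<open>gcd q m\<close> instead of \<open>q\<close> makes the condition void at the prime powers coprime to \<open>q\<close>.
\<close>

definition shifted_units :: "nat \<Rightarrow> nat \<Rightarrow> nat set" where
  "shifted_units q m = {x. x < m \<and> coprime (Suc x) m \<and> gcd q m dvd x}"

lemma finite_shifted_units [simp]: "finite (shifted_units q m)"
  unfolding shifted_units_def by simp

section \<open>Factorisation over coprime moduli by the Chinese remainder theorem\<close>

lemma gcd_mult_coprime:
  fixes q m n :: nat
  assumes "coprime m n"
  shows "gcd q (m * n) = gcd q m * gcd q n"
proof (rule dvd_antisym)
  show "gcd q (m * n) dvd gcd q m * gcd q n"
    by (metis gcd_greatest dvd_mult gcd_dvd1 gcd_dvd2 gcd_mult_distrib_nat mult.commute)
  show "gcd q m * gcd q n dvd gcd q (m * n)"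
    by (meson assms coprime_divisors divides_mult gcd_dvd1 gcd_dvd2 gcd_greatest mult_dvd_mono)
qed

lemma gcd_mod_mult_coprime:
  fixes x m n :: nat
  assumes "coprime m n"
  shows "gcd x (m * n) = gcd (x mod m) m * gcd (x mod n) n"
  by (simp only: gcd_mult_coprime[OF assms] gcd_red_nat[of x m] gcd_red_nat[of x n]
      gcd.commute[of "x mod m"] gcd.commute[of "x mod n"])

text \<open>The Chinese remainder bijection respects the conditions on \<open>x\<close>: coprimality
  splits over the two moduli, and so does divisibility, since \<open>gcd q (m * n)\<close> is the
  product of the coprime numbers \<open>gcd q m\<close> and \<open>gcd q n\<close>.\<close>

lemma bij_betw_shifted_units_mult:
  assumes "coprime m n" "m > 0" "n > 0"
  shows "bij_betw (\<lambda>x. (x mod m, x mod n)) (shifted_units q (m * n))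
           (shifted_units q m \<times> shifted_units q n)"
proof -
  have mem: "x \<in> shifted_units q (m * n) \<longleftrightarrow>
      x < m * n \<and> x mod m \<in> shifted_units q m \<and> x mod n \<in> shifted_units q n" for x
  proof -
    have c: "coprime (Suc (x mod l)) l \<longleftrightarrow> coprime (Suc x) l" if "l > 0" for l
      using that by (metis coprime_mod_left_iff mod_Suc_eq neq0_conv)
    \<comment> \<open>As \<open>gcd q l\<close> divides \<open>l\<close>, reduction modulo
      \<open>l\<close> preserves divisibility by it.\<close>
    have d: "gcd q l dvd x mod l \<longleftrightarrow> gcd q l dvd x" for l
      by (simp add: dvd_mod_iff)
    have "coprime (gcd q m) (gcd q n)"
      using assms(1) by (meson coprime_divisors gcd_dvd2)
    hence "gcd q (m * n) dvd x \<longleftrightarrow> gcd q m dvd x \<and> gcd q n dvd x"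
      unfolding gcd_mult_coprime[OF assms(1)] by (meson divides_mult dvd_mult_left dvd_mult_right)
    thus ?thesis
      unfolding shifted_units_def using assms c d by auto
  qed
  show ?thesis
  proof (rule bij_betw_imageI)
    show "inj_on (\<lambda>x. (x mod m, x mod n)) (shifted_units q (m * n))"
    proof (rule inj_onI)
      fix x y assume xy: "x \<in> shifted_units q (m * n)" "y \<in> shifted_units q (m * n)"
        and "(x mod m, x mod n) = (y mod m, y mod n)"
      hence "[x = y] (mod m * n)"
        using assms(1) by (auto simp: cong_def intro: coprime_cong_mult_nat[unfolded cong_def])
      thus "x = y" using xy by (auto simp: mem cong_def)
    qed
    show "(\<lambda>x. (x mod m, x mod n)) ` shifted_units q (m * n)
            = shifted_units q m \<times> shifted_units q n" (is "?f ` ?A = ?B")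
    proof
      show "?f ` ?A \<subseteq> ?B" using mem by auto
      show "?B \<subseteq> ?f ` ?A"
      proof
        fix z assume z: "z \<in> ?B"
        then obtain u v where uv: "z = (u, v)" "u \<in> shifted_units q m" "v \<in> shifted_units q n"
          by auto
        obtain x where x: "x < m * n" "[x = u] (mod m)" "[x = v] (mod n)"
          using binary_chinese_remainder_unique_nat[OF assms(1), of u v] assms by auto
        have "x mod m = u" "x mod n = v"
          using x uv by (auto simp: cong_def shifted_units_def)
        thus "z \<in> ?f ` ?A" using uv x mem by force
      qed
    qed
  qed
qed

text \<open>The weight \<open>c\<close> is left general so that one argument serves both the
  cardinality (\<open>c\<close> constantly 1) and the sum of square roots.\<close>

lemma sum_shifted_units_mult:
  fixes c :: "nat \<Rightarrow> real"
  assumes "coprime m n" "m > 0" "n > 0" and c: "\<And>a b. c (a * b) = c a * c b"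
  shows "(\<Sum>x\<in>shifted_units q (m * n). c (gcd x (m * n))) =
         (\<Sum>x\<in>shifted_units q m. c (gcd x m)) * (\<Sum>x\<in>shifted_units q n. c (gcd x n))"
proof -
  have "(\<Sum>x\<in>shifted_units q (m * n). c (gcd x (m * n))) =
        (\<Sum>x\<in>shifted_units q (m * n). (\<lambda>(u, v). c (gcd u m) * c (gcd v n)) (x mod m, x mod n))"
    by (simp add: gcd_mod_mult_coprime[OF assms(1)] c)
  also have "\<dots> = (\<Sum>(u, v)\<in>shifted_units q m \<times> shifted_units q n. c (gcd u m) * c (gcd v n))"
    by (rule sum.reindex_bij_betw[OF bij_betw_shifted_units_mult[OF assms(1-3)]])
  finally show ?thesis by (simp add: sum_product sum.cartesian_product)
qed

lemma sum_shifted_units_prime_powers: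
  fixes c :: "nat \<Rightarrow> real"
  assumes "finite P" "\<And>p. p \<in> P \<Longrightarrow> prime p"
    and c: "c 1 = 1" "\<And>a b. c (a * b) = c a * c b"
  shows "(\<Sum>x\<in>shifted_units q (\<Prod>p\<in>P. p ^ e p). c (gcd x (\<Prod>p\<in>P. p ^ e p))) =
         (\<Prod>p\<in>P. \<Sum>x\<in>shifted_units q (p ^ e p). c (gcd x (p ^ e p)))"
  using assms(1,2)
proof (induction P rule: finite_induct)
  case empty
  \<comment> \<open>Modulo 1 only the residue 0 survives, so the sum is \<open>c 1 = 1\<close>, the
    empty product.\<close>
  have "shifted_units q 1 = {0}" by (auto simp: shifted_units_def)
  thus ?case using c by simp
next
  case (insert p P)
  have "coprime (p ^ e p) (\<Prod>p\<in>P. p ^ e p)"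
    using insert by (intro prod_coprime_right) (auto intro!: primes_coprime)
  moreover have "p ^ e p > 0" "(\<Prod>p\<in>P. p ^ e p) > 0"
    using insert by (auto intro!: prod_pos simp: prime_gt_0_nat)
  ultimately show ?case
    using insert by (simp add: sum_shifted_units_mult[OF _ _ _ c(2)])
qed

section \<open>Residue classes and gcd sums at a prime power\<close>

lemma residue_class_eq_image:
  fixes p N c :: nat
  assumes "c < p"
  shows "{x. x < p * N \<and> x mod p = c} = (\<lambda>y. p * y + c) ` {..<N}"
proof
  show "{x. x < p * N \<and> x mod p = c} \<subseteq> (\<lambda>y. p * y + c) ` {..<N}"
  proof
    fix x assume x: "x \<in> {x. x < p * N \<and> x mod p = c}"
    hence "x = p * (x div p) + c" by auto
    moreover have "x div p < N"
      using x by (simp add: less_mult_imp_div_less mult.commute)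
    ultimately show "x \<in> (\<lambda>y. p * y + c) ` {..<N}" by blast
  qed
next
  have "p * y + c < p * N" if "y < N" for y
  proof -
    have "p * y + c < p * Suc y" using assms by simp
    also have "\<dots> \<le> p * N" using that by (intro mult_le_mono2) simp
    finally show ?thesis .
  qed
  thus "(\<lambda>y. p * y + c) ` {..<N} \<subseteq> {x. x < p * N \<and> x mod p = c}"
    using assms by auto
qed

lemma card_residue_class:
  fixes p N c :: nat
  assumes "c < p"
  shows "card {x. x < p * N \<and> x mod p = c} = N"
  unfolding residue_class_eq_image[OF assms]
  using assms by (subst card_image) (auto simp: inj_on_def)

lemma sum_multiples:
  fixes f :: "nat \<Rightarrow> real"
  assumes "p > 0"
  shows "(\<Sum>x | x < p * N \<and> p dvd x. f x) = (\<Sum>y<N. f (p * y))"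
proof -
  have "{x. x < p * N \<and> p dvd x} = (\<lambda>y. p * y) ` {..<N}"
    using residue_class_eq_image[of 0 p N] assms by (simp add: dvd_eq_mod_eq_0)
  thus ?thesis using assms by (simp add: sum.reindex inj_on_def)
qed

text \<open>Non-multiples of \<open>p\<close> contribute 1 each, and multiples \<open>p * y\<close>
  reproduce the previous sum times \<open>sqrt p\<close>, which gives a recursion in
  \<open>n\<close>. The extra factor \<open>sqrt p\<close> on the left avoids division and makes
  that side the sum over the multiples of \<open>p\<close> below \<open>p ^ (n + 1)\<close>.\<close>

lemma sum_sqrt_gcd_prime_power:
  fixes p n :: nat
  assumes "prime p"
  shows "sqrt p * (\<Sum>y<p ^ n. sqrt (gcd y (p ^ n)))
           = sqrt p ^ (2 * n + 1) + sqrt p ^ (2 * n) - sqrt p ^ n"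
proof (induction n)
  case 0
  show ?case by simp
next
  case (Suc n)
  have p: "p > 0" using assms by (simp add: prime_gt_0_nat)
  define r where "r = sqrt p"
  have r2: "r ^ 2 = real p" by (simp add: r_def)
  have rp: "r ^ (2 * n) = real p ^ n" by (simp add: power_mult r2)
  have "(\<Sum>y<p ^ Suc n. sqrt (gcd y (p ^ Suc n))) =
      (\<Sum>y\<in>{..<p * p ^ n} - {x. x < p * p ^ n \<and> p dvd x}. sqrt (gcd y (p ^ Suc n))) +
      (\<Sum>y | y < p * p ^ n \<and> p dvd y. sqrt (gcd y (p ^ Suc n)))"
    unfolding power_Suc by (rule sum.subset_diff) auto
  also have "(\<Sum>y | y < p * p ^ n \<and> p dvd y. sqrt (gcd y (p ^ Suc n)))
      = r * (\<Sum>y<p ^ n. sqrt (gcd y (p ^ n)))"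
    using p by (simp add: sum_multiples gcd_mult_distrib_nat[symmetric] real_sqrt_mult r_def sum_distrib_left)
  also have "(\<Sum>y\<in>{..<p * p ^ n} - {x. x < p * p ^ n \<and> p dvd x}. sqrt (gcd y (p ^ Suc n)))
      = (\<Sum>y\<in>{..<p * p ^ n} - {x. x < p * p ^ n \<and> p dvd x}. 1)"
  proof (rule sum.cong[OF refl])
    fix y assume "y \<in> {..<p * p ^ n} - {x. x < p * p ^ n \<and> p dvd x}"
    hence "coprime y (p ^ Suc n)"
      using assms by (metis DiffE lessThan_iff mem_Collect_eq prime_imp_coprime coprime_commute coprime_power_right_iff)
    thus "sqrt (gcd y (p ^ Suc n)) = 1" by (simp add: coprime_iff_gcd_eq_1)
  qed
  also have "\<dots> = real p ^ Suc n - real p ^ n"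
  proof -
    have "card {x. x < p * p ^ n \<and> p dvd x} = p ^ n"
      using card_residue_class[of 0 p "p ^ n"] p by (simp add: dvd_eq_mod_eq_0)
    hence "card ({..<p * p ^ n} - {x. x < p * p ^ n \<and> p dvd x}) = p * p ^ n - p ^ n"
      by (subst card_Diff_subset) auto
    thus ?thesis using p by (simp add: of_nat_diff)
  qed
  \<comment> \<open>The first bracket is the count of non-multiples written in powers of
    \<open>r\<close>, the second the induction hypothesis. After expansion the terms
    \<open>r ^ (2 * n + 1)\<close> cancel.\<close>
  finally have "r * (\<Sum>y<p ^ Suc n. sqrt (gcd y (p ^ Suc n))) =
      r * ((r ^ 2 * r ^ (2 * n) - r ^ (2 * n)) + (r ^ (2 * n + 1) + r ^ (2 * n) - r ^ n))"
    using Suc.IH by (simp add: r_def[symmetric] r2 rp)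
  thus ?case by (simp add: r_def[symmetric] algebra_simps power2_eq_square)
qed

section \<open>The closed forms at one prime power\<close>

text \<open>The base of the square in the denominator of \<open>beta\<close>; it will be the local
  sum at \<open>q\<close> itself.\<close>

definition local_sum_one :: "nat \<Rightarrow> nat \<Rightarrow> real" where
  "local_sum_one p \<alpha> = - (real p powr ((real \<alpha> - 1) / 2)) + real p powr (real \<alpha> - 1)
     + real p powr (real \<alpha> - 1 / 2)"

text \<open>The base of the square in the denominator of \<open>R_factor\<close> and the numerator
  of \<open>beta\<close>; it will be the local sum at primes other than \<open>q\<close>.\<close>

definition local_sum :: "nat \<Rightarrow> nat \<Rightarrow> real" where
  "local_sum p \<alpha> = real p powr real \<alpha> - real p powr (real \<alpha> - 1)
     - real p powr ((real \<alpha> - 1) / 2) + real p powr (real \<alpha> - 1 / 2)"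

lemma local_sum_one_Suc:
  assumes "prime p"
  shows "local_sum_one p (Suc n) = sqrt p ^ (2 * n + 1) + sqrt p ^ (2 * n) - sqrt p ^ n"
proof -
  have p: "real p > 0" using assms by (simp add: prime_gt_0_nat)
  have s: "sqrt p ^ m = real p powr (real m / 2)" for m
    using p by (simp add: powr_half_sqrt[symmetric] powr_realpow[symmetric] powr_powr)
  show ?thesis unfolding s local_sum_one_def by (simp add: field_simps)
qed

text \<open>The difference \<open>(real p - 2) * real p ^ n\<close> is the number of units modulo
  \<open>p ^ Suc n\<close> that are not 1 modulo \<open>p\<close>; each of them will contribute
  1.\<close>

lemma local_sum_Suc:
  assumes "prime p"
  shows "local_sum p (Suc n) = local_sum_one p (Suc n) + (real p - 2) * real p ^ n"
proof -
  have p: "real p > 0" using assms by (simp add: prime_gt_0_nat)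
  have "real p powr (real (Suc n)) = real p * real p ^ n" "real p powr (real (Suc n) - 1) = real p ^ n"
    using p powr_realpow[of "real p" "Suc n"] powr_realpow[of "real p" n] by (simp_all add: add.commute)
  thus ?thesis by (simp add: local_sum_def local_sum_one_def algebra_simps)
qed

lemma local_sum_one_pos:
  assumes "prime p"
  shows "local_sum_one p (Suc n) > 0"
proof -
  have "sqrt p \<ge> 1" using prime_ge_1_nat[OF assms] by simp
  hence "sqrt p ^ n \<le> sqrt p ^ (2 * n)" "sqrt p ^ (2 * n + 1) > 0"
    by (auto intro!: power_increasing zero_less_power)
  thus ?thesis by (simp add: local_sum_one_Suc[OF assms])
qed

lemma local_sum_pos:
  assumes "prime p"
  shows "local_sum p (Suc n) > 0"
proof -
  have "(real p - 2) * real p ^ n \<ge> 0" using prime_ge_2_nat[OF assms] by simp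
  thus ?thesis using local_sum_one_pos[OF assms, of n] by (simp add: local_sum_Suc[OF assms])
qed

section \<open>Sizes and sums of the local sets\<close>

text \<open>If \<open>p\<close> divides \<open>x\<close> then \<open>Suc x\<close> is automatically
  prime to \<open>p\<close>, so only the divisibility remains.\<close>

lemma shifted_units_same_prime:
  assumes "prime p"
  shows "shifted_units p (p ^ Suc n) = {x. x < p * p ^ n \<and> p dvd x}"
proof -
  have "coprime (Suc x) (p ^ Suc n)" if "p dvd x" for x
    using that assms
    by (metis coprime_Suc_left_nat coprime_divisors coprime_power_right_iff dvd_refl)
  moreover have "gcd p (p ^ Suc n) = p" by simp
  ultimately show ?thesis unfolding shifted_units_def by auto
qed

text \<open>The divisibility condition is void here, and \<open>Suc x\<close> fails to be a unit
  exactly when \<open>x\<close> is -1 modulo \<open>p\<close>.\<close>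

lemma shifted_units_other_prime:
  assumes "prime p" "prime q" "p \<noteq> q"
  shows "shifted_units q (p ^ Suc n) = {..<p * p ^ n} - {x. x < p * p ^ n \<and> x mod p = p - 1}"
proof -
  have p: "p > 1" using assms prime_gt_1_nat by blast
  have "coprime q (p ^ Suc n)" using assms by (metis primes_coprime coprime_power_right_iff)
  hence "gcd q (p ^ Suc n) = 1" by (simp add: coprime_iff_gcd_eq_1)
  moreover have "coprime (Suc x) (p ^ Suc n) \<longleftrightarrow> x mod p \<noteq> p - 1" for x
  proof -
    have "coprime (Suc x) (p ^ Suc n) \<longleftrightarrow> \<not> p dvd Suc x"
      using prime_imp_coprime[OF assms(1), of "Suc x"] not_prime_unit[of p] assms(1)
        coprime_common_divisor[of "Suc x" p p]
      by (auto simp: coprime_commute)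
    also have "p dvd Suc x \<longleftrightarrow> x mod p = p - 1"
      using p by (auto simp: dvd_eq_mod_eq_0 mod_Suc)
    finally show ?thesis by simp
  qed
  ultimately show ?thesis unfolding shifted_units_def by auto
qed

lemma card_shifted_units_same_prime:
  assumes "prime p"
  shows "card (shifted_units p (p ^ Suc n)) = p ^ n"
  using card_residue_class[of 0 p "p ^ n"] prime_gt_0_nat[OF assms]
  by (simp add: shifted_units_same_prime[OF assms] dvd_eq_mod_eq_0 del: power_Suc)

lemma card_shifted_units_other_prime:
  assumes "prime p" "prime q" "p \<noteq> q"
  shows "real (card (shifted_units q (p ^ Suc n))) = (real p - 1) * real p ^ n"
proof -
  have p: "p > 0" using assms prime_gt_0_nat by blast
  have "card (shifted_units q (p ^ Suc n)) = p * p ^ n - p ^ n"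
    unfolding shifted_units_other_prime[OF assms]
    using card_residue_class[of "p - 1" p "p ^ n"] p by (subst card_Diff_subset) auto
  thus ?thesis using p by (simp add: of_nat_diff algebra_simps)
qed

lemma sum_shifted_units_same_prime:
  assumes "prime p"
  shows "(\<Sum>x\<in>shifted_units p (p ^ Suc n). sqrt (gcd x (p ^ Suc n))) = local_sum_one p (Suc n)"
  using sum_sqrt_gcd_prime_power[OF assms, of n] prime_gt_0_nat[OF assms]
  unfolding shifted_units_same_prime[OF assms] local_sum_one_Suc[OF assms]
  by (simp add: sum_multiples gcd_mult_distrib_nat[symmetric] real_sqrt_mult sum_distrib_left)

lemma sum_shifted_units_other_prime:
  assumes "prime p" "prime q" "p \<noteq> q"
  shows "(\<Sum>x\<in>shifted_units q (p ^ Suc n). sqrt (gcd x (p ^ Suc n))) = local_sum p (Suc n)"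
proof -
  let ?A = "shifted_units q (p ^ Suc n)" and ?B = "shifted_units p (p ^ Suc n)"
  have p: "p > 1" using assms prime_gt_1_nat by blast
  \<comment> \<open>Multiples of \<open>p\<close> have residue 0, which differs from
    \<open>p - 1\<close> because \<open>p > 1\<close>.\<close>
  have sub: "?B \<subseteq> ?A"
    using p by (auto simp: shifted_units_same_prime[OF assms(1)] shifted_units_other_prime[OF assms]
      simp del: power_Suc)
  have "(\<Sum>x\<in>?A. sqrt (gcd x (p ^ Suc n))) =
      (\<Sum>x\<in>?A - ?B. sqrt (gcd x (p ^ Suc n))) + local_sum_one p (Suc n)"
    unfolding sum_shifted_units_same_prime[OF assms(1), symmetric]
    by (rule sum.subset_diff[OF sub]) simp
  also have "(\<Sum>x\<in>?A - ?B. sqrt (gcd x (p ^ Suc n))) = (\<Sum>x\<in>?A - ?B. 1)"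
  proof (rule sum.cong[OF refl])
    fix x assume "x \<in> ?A - ?B"
    hence "\<not> p dvd x"
      unfolding shifted_units_same_prime[OF assms(1)] by (auto simp: shifted_units_def)
    hence "coprime x (p ^ Suc n)"
      using assms by (metis prime_imp_coprime coprime_commute coprime_power_right_iff)
    thus "sqrt (gcd x (p ^ Suc n)) = 1" by (simp add: coprime_iff_gcd_eq_1)
  qed
  also have "\<dots> = real (card ?A) - real (card ?B)"
    using sub by (simp add: card_Diff_subset card_mono of_nat_diff del: power_Suc)
  also have "\<dots> = (real p - 2) * real p ^ n"
    unfolding card_shifted_units_other_prime[OF assms] card_shifted_units_same_prime[OF assms(1)]
    by (simp add: algebra_simps)
  finally show ?thesis by (simp add: local_sum_Suc[OF assms(1)])
qed

section \<open>Assembling the local quotients\<close>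

lemma R_factor_eq_shifted_units:
  assumes "prime p" "prime q" "p \<noteq> q" "\<alpha> > 0"
  shows "real (card (shifted_units q (p ^ \<alpha>))) /
    (\<Sum>x\<in>shifted_units q (p ^ \<alpha>). sqrt (gcd x (p ^ \<alpha>)))\<^sup>2 = R_factor p \<alpha>"
proof -
  obtain n where n: "\<alpha> = Suc n" using assms(4) gr0_conv_Suc by blast
  have "real p ^ n = real p powr (real \<alpha> - 1)"
    using prime_gt_0_nat[OF assms(1)] by (simp add: n powr_realpow)
  thus ?thesis
    unfolding n card_shifted_units_other_prime[OF assms(1-3)] sum_shifted_units_other_prime[OF assms(1-3)]
    by (simp add: R_factor_def local_sum_def n)
qed

text \<open>\<open>beta\<close> is the correction at the distinguished prime: it replaces
  \<open>local_sum\<close> by \<open>local_sum_one\<close> in the denominator and removes the factor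
  \<open>p - 1\<close> from the numerator. Positivity justifies the cancellation.\<close>

lemma R_factor_beta_eq_shifted_units:
  assumes "prime p" "\<alpha> > 0"
  shows "real (card (shifted_units p (p ^ \<alpha>))) /
    (\<Sum>x\<in>shifted_units p (p ^ \<alpha>). sqrt (gcd x (p ^ \<alpha>)))\<^sup>2 = R_factor p \<alpha> * beta p \<alpha>"
proof -
  obtain n where n: "\<alpha> = Suc n" using assms(2) gr0_conv_Suc by blast
  have "real p ^ n = real p powr (real \<alpha> - 1)"
    using prime_gt_0_nat[OF assms(1)] by (simp add: n powr_realpow)
  hence R: "R_factor p \<alpha> = (real p - 1) * real p ^ n / (local_sum p \<alpha>)\<^sup>2"
    by (simp add: R_factor_def local_sum_def)
  have B: "beta p \<alpha> = (local_sum p \<alpha>)\<^sup>2 / ((real p - 1) * (local_sum_one p \<alpha>)\<^sup>2)"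
    by (simp add: beta_def local_sum_def local_sum_one_def)
  have "local_sum p \<alpha> > 0" "local_sum_one p \<alpha> > 0" "real p - 1 > 0"
    using local_sum_pos[OF assms(1)] local_sum_one_pos[OF assms(1)] prime_gt_1_nat[OF assms(1)]
    by (auto simp: n)
  thus ?thesis
    unfolding R B unfolding n card_shifted_units_same_prime[OF assms(1)]
      sum_shifted_units_same_prime[OF assms(1)]
    by (simp add: divide_simps)
qed

lemma R_prod_beta_eq_shifted_units:
  assumes "k > 0" "prime q" "q dvd k"
  shows "real (card (shifted_units q k)) / (\<Sum>x\<in>shifted_units q k. sqrt (gcd x k))\<^sup>2
    = R_prod k * beta q (multiplicity q k)"
proof -
  let ?e = "\<lambda>p. multiplicity p k"
  let ?P = "prime_factors k"
  define g where "g p = real (card (shifted_units q (p ^ ?e p))) /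
    (\<Sum>x\<in>shifted_units q (p ^ ?e p). sqrt (gcd x (p ^ ?e p)))\<^sup>2" for p
  have k: "(\<Prod>p\<in>?P. p ^ ?e p) = k"
    using assms(1) by (simp add: prime_factorization_nat[symmetric])
  have pr: "\<And>p. p \<in> ?P \<Longrightarrow> prime p" by auto
  have q: "q \<in> ?P" using assms by (simp add: prime_factors_dvd)
  have e: "?e p > 0" if "p \<in> ?P" for p
    using that assms(1) by (simp add: prime_factors_multiplicity)
  have card: "real (card (shifted_units q k)) = (\<Prod>p\<in>?P. real (card (shifted_units q (p ^ ?e p))))"
    using sum_shifted_units_prime_powers[of ?P "\<lambda>_. 1" ?e q] pr by (simp add: k)
  have sum: "(\<Sum>x\<in>shifted_units q k. sqrt (gcd x k)) =
      (\<Prod>p\<in>?P. \<Sum>x\<in>shifted_units q (p ^ ?e p). sqrt (gcd x (p ^ ?e p)))"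
    using sum_shifted_units_prime_powers[of ?P "\<lambda>n. sqrt (real n)" ?e q] pr
    by (simp add: k real_sqrt_mult)
  have "real (card (shifted_units q k)) / (\<Sum>x\<in>shifted_units q k. sqrt (gcd x k))\<^sup>2 = (\<Prod>p\<in>?P. g p)"
    unfolding card sum g_def by (simp add: prod_dividef prod_power_distrib)
  \<comment> \<open>The factor at \<open>q\<close> is isolated, being the only one that carries
    \<open>beta\<close>.\<close>
  also have "\<dots> = g q * (\<Prod>p\<in>?P - {q}. g p)"
    using q by (simp add: prod.remove)
  also have "(\<Prod>p\<in>?P - {q}. g p) = (\<Prod>p\<in>?P - {q}. R_factor p (?e p))"
    unfolding g_def using assms(2) pr e by (intro prod.cong refl R_factor_eq_shifted_units) auto
  also have "g q = R_factor q (?e q) * beta q (?e q)"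
    unfolding g_def using assms(2) e q by (intro R_factor_beta_eq_shifted_units) auto
  also have "R_factor q (?e q) * beta q (?e q) * (\<Prod>p\<in>?P - {q}. R_factor p (?e p)) =
      (\<Prod>p\<in>?P. R_factor p (?e p)) * beta q (?e q)"
    using q by (simp add: prod.remove)
  also have "(\<Prod>p\<in>?P. R_factor p (?e p)) = R_prod k"
  proof -
    have "exact_prime_powers k = (\<lambda>p. (p, ?e p)) ` ?P"
      using assms(1) by (auto simp: exact_prime_powers_def prime_factors_dvd)
    thus ?thesis by (simp add: R_prod_def prod.reindex inj_on_def)
  qed
  finally show ?thesis .
qed

section \<open>From the explicit subset to the bound on \<open>eta\<close>\<close>

lemma eta_le:
  assumes "I \<subseteq> base_set k" "I \<noteq> {}"
  shows "eta k \<le> real (card I) / (T_sum k I)\<^sup>2"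
proof -
  have "finite (base_set k)"
    by (rule finite_subset[of _ "{..k}"]) (auto simp: base_set_def)
  moreover have "{real (card I) / (T_sum k I)\<^sup>2 | I. I \<subseteq> base_set k \<and> I \<noteq> {}} \<subseteq>
      (\<lambda>I. real (card I) / (T_sum k I)\<^sup>2) ` Pow (base_set k)" by blast
  ultimately have "finite {real (card I) / (T_sum k I)\<^sup>2 | I. I \<subseteq> base_set k \<and> I \<noteq> {}}"
    by (meson finite_Pow_iff finite_imageI finite_subset)
  thus ?thesis unfolding eta_def using assms by (intro Min_le) auto
qed

lemma eta_le_R_prod_beta:
  assumes "k > 0" "prime q" "q dvd k"
  shows "eta k \<le> R_prod k * beta q (multiplicity q k)"
proof -
  \<comment> \<open>\<open>Suc\<close> undoes the shift \<open>x = i - 1\<close>.\<close>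
  let ?I = "Suc ` shifted_units q k"
  have gcd: "gcd x k > 1" if "gcd q k dvd x" for x
  proof -
    have "q dvd gcd x k" using that assms by (simp add: gcd_nat.absorb1)
    hence "q \<le> gcd x k" using assms(1) by (intro dvd_imp_le) auto
    thus ?thesis using prime_gt_1_nat[OF assms(2)] by linarith
  qed
  have "?I \<subseteq> base_set k"
  proof
    fix i assume "i \<in> ?I"
    then obtain x where "i = Suc x" "x < k" "coprime (Suc x) k" "gcd q k dvd x"
      by (auto simp: shifted_units_def)
    thus "i \<in> base_set k" using gcd[of x] unfolding base_set_def by simp
  qed
  \<comment> \<open>The witness is \<open>i = 1\<close>, where
    \<open>gcd (i - 1) k = k\<close>.\<close>
  moreover have "0 \<in> shifted_units q k"
    using assms by (simp add: shifted_units_def)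
  hence "?I \<noteq> {}" by blast
  ultimately have "eta k \<le> real (card ?I) / (T_sum k ?I)\<^sup>2" by (rule eta_le)
  also have "\<dots> = real (card (shifted_units q k)) / (\<Sum>x\<in>shifted_units q k. sqrt (gcd x k))\<^sup>2"
    by (simp add: T_sum_def card_image sum.reindex)
  also have "\<dots> = R_prod k * beta q (multiplicity q k)"
    by (rule R_prod_beta_eq_shifted_units[OF assms])
  finally show ?thesis .
qed

theorem theorem5p5:
  fixes k :: nat
  assumes "k \<ge> 2"
  shows "eta k \<le> mu k"
proof -
  let ?S = "{beta p \<alpha> | p \<alpha>. (p, \<alpha>) \<in> exact_prime_powers k}"
  \<comment> \<open>As an image of \<open>prime_factors k\<close> the set is finite; with
    nonemptiness, from a prime divisor of \<open>k\<close>, the minimum is attained at some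
    \<open>q\<close>.\<close>
  have S: "?S = (\<lambda>p. beta p (multiplicity p k)) ` prime_factors k"
    using assms by (auto simp: exact_prime_powers_def prime_factors_dvd)
  obtain p where "prime p" "p dvd k"
    using assms prime_factor_nat[of k] by auto
  hence "?S \<noteq> {}" by (auto simp: exact_prime_powers_def)
  hence "Min ?S \<in> ?S" by (intro Min_in) (simp_all add: S)
  then obtain q where "prime q" "q dvd k" "Min ?S = beta q (multiplicity q k)"
    by (auto simp: exact_prime_powers_def)
  thus ?thesis
    using eta_le_R_prod_beta[of k q] assms by (simp add: mu_def)
qed

end
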